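(* Let $q$ be an odd prime power and let $\gamma\in\mathbb{F}_{q^2}$. If $\mathrm{char}(\mathbb{F}_{q^2})\neq3$, the polynomial $f(x)=x+\gamma\,\mathrm{Tr}\left(x^4+x^{q+3}\right)$ over $\mathbb{F}_{q^2}$ is a permutation polynomial if and only if $\gamma=0$. If $\mathrm{char}(\mathbb{F}_{q^2})=3$, the polynomial $f(x)=x+\gamma\,\mathrm{Tr}\left(x^4+x^{q+3}\right)$ over $\mathbb{F}_{q^2}$ is a permutation polynomial if and only if $\alpha\gamma\in\mathbb{F}_q$, where $\alpha\in\mathbb{F}_{q^2}$ satisfies $\alpha^2=u$ and $u\in\mathbb{F}_q$ is a quadratic non-residue in $\mathbb{F}_q$.
   Context: $\mathrm{Tr}:\mathbb{F}_{q^2}\to\mathbb{F}_q$ is the trace map $\mathrm{Tr}(x)=x+x^q$. A polynomial $f$ over $\mathbb{F}_{q^2}$ is a permutation polynomial if the map $x\mapsto f(x)$ is a bijection of $\mathbb{F}_{q^2}$ onto itself. $\mathrm{char}(\mathbb{F}_{q^2})$ is the characteristic of $\mathbb{F}_{q^2}$. The elements $u$ and $\alpha$ are arbitrary but fixed with the stated properties. *)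

theory Defs
  imports
    "HOL-Number_Theory.Prime_Powers"
    "HOL-Algebra.Algebraic_Closure_Type"
    "HOL-Library.Cardinality"
begin

definition permutation_polynomial :: "'a::comm_semiring_0 poly \<Rightarrow> bool" where
  "permutation_polynomial f \<longleftrightarrow> bij (poly f)"

text \<open>
  On the field with \<open>q\<^sup>2\<close> elements this is the trace to the subfield with \<open>q\<close> elements.
  The type is more general so that the same expression can be formed with a polynomial
  as argument; evaluation commutes with it.
\<close>
definition Tr :: "nat \<Rightarrow> 'a::semiring_1 \<Rightarrow> 'a" where
  "Tr q x = x + x ^ q"

text \<open>
  Squares are taken within \<open>K\<close> only. As \<open>0\<close> is a square, a non-residue is nonzero.
\<close>
definition quadratic_nonresidue_in :: "'a::semiring_1 set \<Rightarrow> 'a \<Rightarrow> bool" where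
  "quadratic_nonresidue_in K u \<longleftrightarrow> u \<in> K \<and> \<not> (\<exists>v\<in>K. v\<^sup>2 = u)"

definition trace_poly :: "nat \<Rightarrow> 'a::comm_ring_1 \<Rightarrow> 'a poly" where
  "trace_poly q \<gamma> =
     Polynomial.monom 1 1
       + Polynomial.smult \<gamma> (Tr q (Polynomial.monom 1 4 + Polynomial.monom 1 (q + 3)))"

lemma poly_trace_poly: "poly (trace_poly q \<gamma>) x = x + \<gamma> * Tr q (x ^ 4 + x ^ (q + 3))"
  by (simp add: trace_poly_def Tr_def poly_monom)

end

theory Submission
  imports Defs "HOL-Number_Theory.Residues"
begin

text \<open>
  Write the larger field as \<open>K \<oplus> K\<alpha>\<close> with \<open>\<alpha>\<^sup>q = -\<alpha>\<close>, and put \<open>u = \<alpha>\<^sup>2 \<in> K\<close>. The trace of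
  \<open>x\<^sup>4 + x\<^bsup>q+3\<^esup>\<close> at \<open>x = a + b\<alpha>\<close> is \<open>h(x) = 4a\<^sup>2(a\<^sup>2 + 3ub\<^sup>2)\<close>.

  If \<open>3 \<noteq> 0\<close> and \<open>\<gamma> = c + d\<alpha> \<noteq> 0\<close>, a collision \<open>f(m - s\<gamma>) = f(m + s\<gamma>)\<close> with \<open>s \<in> K\<close> nonzero amounts
  to \<open>h(m + s\<gamma>) - h(m - s\<gamma>) = -2s\<close>. Centring the pair at \<open>m\<close> makes the left side odd in \<open>s\<close>, so
  after division by \<open>2s\<close> only \<open>s\<^sup>2\<close> occurs. The equation is then linear in one coordinate of \<open>m\<close> for
  a suitable choice of the other variables if \<open>d \<noteq> 0\<close>, and a nondegenerate conic if \<open>d = 0\<close>.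

  If \<open>3 = 0\<close>, then \<open>h(x) = a\<^sup>4\<close> and \<open>f\<close> maps \<open>(a, b)\<close> to \<open>(a + ca\<^sup>4, b + da\<^sup>4)\<close>. This is injective
  exactly if \<open>c = 0\<close>, since otherwise \<open>-1/c\<close> is a cube in \<open>K\<close>; and \<open>c = 0\<close> means \<open>\<alpha>\<gamma> \<in> K\<close>.
\<close>

section \<open>Subfields of a finite field\<close>

text \<open>Multiplication by a nonzero \<open>x\<close> permutes \<open>K - {0}\<close>; comparing
  products over this set gives \<open>x ^ (card K - 1) = 1\<close>. It serves both the subfield and
  the whole field.\<close>

lemma power_card_eq_same:
  fixes K :: "'a::idom set"
  assumes "finite K" "0 \<in> K" "\<And>x y. x \<in> K \<Longrightarrow> y \<in> K \<Longrightarrow> x * y \<in> K" "x \<in> K"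
  shows "x ^ card K = x"
proof (cases "x = 0")
  case True
  then show ?thesis
    using assms by (auto simp: card_gt_0_iff)
next
  case False
  have "inj_on ((*) x) (K - {0})"
    using False by (auto simp: inj_on_def)
  moreover have "(*) x ` (K - {0}) \<subseteq> K - {0}"
    using assms False by auto
  ultimately have bij: "bij_betw ((*) x) (K - {0}) (K - {0})"
    using assms(1) by (simp add: bij_betw_def endo_inj_surj)
  have "\<Prod>(K - {0}) = (\<Prod>y\<in>K - {0}. x * y)"
    using prod.reindex_bij_betw[OF bij, of "\<lambda>y. y"] by simp
  also have "\<dots> = x ^ card (K - {0}) * \<Prod>(K - {0})"
    by (simp add: prod.distrib)
  finally have "x ^ card (K - {0}) = 1"
    using assms(1) by simp
  then have "x ^ Suc (card (K - {0})) = x"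
    by simp
  then show ?thesis
    using assms(1,2) by (simp only: card_Suc_Diff1)
qed

text \<open>Closure is phrased with the type-class operations, so that arithmetic inside
  \<open>K\<close> is ordinary field arithmetic.\<close>

locale finite_subfield =
  fixes K :: "'a::{field,finite} set"
  assumes zero [simp]: "0 \<in> K" and one [simp]: "1 \<in> K"
    and add [intro]: "x \<in> K \<Longrightarrow> y \<in> K \<Longrightarrow> x + y \<in> K"
    and uminus [intro]: "x \<in> K \<Longrightarrow> - x \<in> K"
    and mult [intro]: "x \<in> K \<Longrightarrow> y \<in> K \<Longrightarrow> x * y \<in> K"
    and inverse [intro]: "x \<in> K \<Longrightarrow> inverse x \<in> K"
begin

lemma diff [intro]: "x \<in> K \<Longrightarrow> y \<in> K \<Longrightarrow> x - y \<in> K"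
  using add[of x "- y"] by auto

lemma divide [intro]: "x \<in> K \<Longrightarrow> y \<in> K \<Longrightarrow> x / y \<in> K"
  by (auto simp: divide_inverse)

lemma power [intro]: "x \<in> K \<Longrightarrow> x ^ n \<in> K"
  by (induction n) auto

lemma of_nat [simp]: "of_nat n \<in> K"
  by (induction n) auto

lemma numeral [simp]: "numeral n \<in> K"
  using of_nat[of "numeral n"] by simp

lemma power_card: "x \<in> K \<Longrightarrow> x ^ card K = x"
  by (rule power_card_eq_same) auto

text \<open>All elements of \<open>K\<close> are roots of \<open>X ^ card K - X\<close>, which has
  at most \<open>card K\<close> roots.\<close>

lemma eq_fixed_points: "K = {x. x ^ card K = x}"
proof (rule card_seteq)
  let ?p = "Polynomial.monom 1 (card K) - Polynomial.monom 1 1 :: 'a poly"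
  have "{0, 1} \<subseteq> K"
    by simp
  then have "card {0, 1 :: 'a} \<le> card K"
    by (intro card_mono) auto
  then have gt: "card K > 1"
    by simp
  then have "poly.coeff ?p (card K) = 1"
    by (simp add: coeff_monom)
  then have "?p \<noteq> 0"
    by (metis coeff_0 zero_neq_one)
  then have "card {x. poly ?p x = 0} \<le> degree ?p"
    by (rule card_poly_roots_bound)
  also have "degree ?p \<le> card K"
    using gt by (intro degree_diff_le) (auto intro: order_trans[OF degree_monom_le])
  also have "{x. poly ?p x = 0} = {x :: 'a. x ^ card K = x}"
    by (simp add: poly_monom)
  finally show "card {x :: 'a. x ^ card K = x} \<le> card K" .
qed (auto simp: power_card)

section \<open>Squares and binary quadratic forms\<close>

lemma card_le_twice_card_squares: "card K \<le> 2 * card ((\<lambda>x. x\<^sup>2) ` K)"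
proof -
  have fibre: "card {x \<in> K. x\<^sup>2 = y} \<le> 2" for y
  proof (cases "\<exists>z. z\<^sup>2 = y")
    case True
    then obtain z where "z\<^sup>2 = y" ..
    then have "{x \<in> K. x\<^sup>2 = y} \<subseteq> {z, - z}"
      by (auto simp: power2_eq_iff)
    then have "card {x \<in> K. x\<^sup>2 = y} \<le> card {z, - z}"
      by (intro card_mono) auto
    also have "\<dots> \<le> 2"
      by (simp add: card_insert_if)
    finally show ?thesis .
  next
    case False
    then have "{x \<in> K. x\<^sup>2 = y} = {}"
      by auto
    then show ?thesis
      by (metis card.empty zero_le)
  qed
  have "card K = card (\<Union>y\<in>(\<lambda>x. x\<^sup>2) ` K. {x \<in> K. x\<^sup>2 = y})"
    by (rule arg_cong[of _ _ card]) auto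
  also have "\<dots> \<le> (\<Sum>y\<in>(\<lambda>x. x\<^sup>2) ` K. card {x \<in> K. x\<^sup>2 = y})"
    by (rule card_UN_le) simp
  also have "\<dots> \<le> (\<Sum>y\<in>(\<lambda>x. x\<^sup>2) ` K. 2)"
    by (intro sum_mono fibre)
  finally show ?thesis
    by simp
qed

text \<open>Pigeonhole: as \<open>card K\<close> is odd, more than half of its elements are squares,
  so the value sets of \<open>p * x\<^sup>2\<close> and \<open>k - r * y\<^sup>2\<close>
  meet.\<close>

lemma binary_form_represents:
  assumes "odd (card K)" "p \<in> K" "r \<in> K" "k \<in> K" "p \<noteq> 0" "r \<noteq> 0"
  shows "\<exists>x\<in>K. \<exists>y\<in>K. p * x\<^sup>2 + r * y\<^sup>2 = k"
proof -
  let ?S = "(\<lambda>x. x\<^sup>2) ` K"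
  let ?A = "(\<lambda>v. p * v) ` ?S" and ?B = "(\<lambda>v. k - r * v) ` ?S"
  have "card ?A = card ?S" "card ?B = card ?S"
    using assms by (auto intro!: card_image simp: inj_on_def)
  moreover have "card K < 2 * card ?S"
    using card_le_twice_card_squares assms(1) by (metis dvd_triv_left order_less_le)
  moreover have "card (?A \<union> ?B) \<le> card K"
    using assms by (intro card_mono) auto
  ultimately have "card (?A \<union> ?B) < card ?A + card ?B"
    by linarith
  then have "?A \<inter> ?B \<noteq> {}"
    by (metis card_Un_disjoint finite less_irrefl)
  then show ?thesis
    by (fastforce simp: algebra_simps)
qed

text \<open>
  A point of the conic on the axis \<open>x = 0\<close> is moved off it by intersecting with the
  lines of slope \<open>1/\<lambda>\<close> through it, for \<open>\<lambda> = 1\<close> or \<open>\<lambda> = 2\<close>.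
\<close>
lemma binary_form_represents_off_axis:
  assumes "odd (card K)" "p \<in> K" "r \<in> K" "k \<in> K" "p \<noteq> 0" "r \<noteq> 0" "k \<noteq> 0"
    and "(2 :: 'a) \<noteq> 0" "(3 :: 'a) \<noteq> 0"
  shows "\<exists>x\<in>K. \<exists>y\<in>K. x \<noteq> 0 \<and> p * x\<^sup>2 + r * y\<^sup>2 = k"
proof -
  obtain x y where xy: "x \<in> K" "y \<in> K" "p * x\<^sup>2 + r * y\<^sup>2 = k"
    using binary_form_represents[OF assms(1-6)] by blast
  show ?thesis
  proof (cases "x = 0")
    case False
    with xy show ?thesis by blast
  next
    case True
    then have y: "r * y\<^sup>2 = k" "y \<noteq> 0"
      using xy assms by auto
    have "\<exists>l\<in>K. l \<noteq> 0 \<and> p * l\<^sup>2 + r \<noteq> 0"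
    proof (cases "p + r = 0")
      case True
      then have "p * 4 + r = 3 * p"
        by Groebner_Basis.algebra
      also have "\<dots> \<noteq> 0"
        using assms by simp
      finally show ?thesis
        using assms by (intro bexI[of _ 2]) auto
    qed (auto intro!: bexI[of _ 1])
    then obtain l where l: "l \<in> K" "l \<noteq> 0" "p * l\<^sup>2 + r \<noteq> 0"
      by blast
    \<comment> \<open>On the line, the form minus \<open>k\<close> is
      \<open>t * (t * (p * l\<^sup>2 + r) + 2 * r * y)\<close>; this is the nonzero root.\<close>
    define t where "t = - (2 * r * y) / (p * l\<^sup>2 + r)"
    have "t * (p * l\<^sup>2 + r) = - (2 * r * y)"
      using l by (simp add: t_def)
    then have "p * (l * t)\<^sup>2 + r * (y + t)\<^sup>2 = k"
      using y(1) by Groebner_Basis.algebra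
    moreover have "t \<in> K"
      unfolding t_def using assms xy l by (intro divide uminus mult add power) auto
    moreover have "t \<noteq> 0"
      using l y assms by (simp add: t_def)
    ultimately show ?thesis
      using l xy by (intro bexI[of _ "l * t"] bexI[of _ "y + t"]) auto
  qed
qed

text \<open>
  The equation \<open>h(m + s\<gamma>) - h(m - s\<gamma>) = -2s\<close> divided by \<open>2s\<close>, with \<open>m = A + B\<alpha>\<close> and
  \<open>\<gamma> = c + d\<alpha>\<close>.
\<close>
lemma collision_equation_solvable:
  assumes "odd (card K)" "(2 :: 'a) \<noteq> 0" "(3 :: 'a) \<noteq> 0"
    and K: "u \<in> K" "c \<in> K" "d \<in> K" and nz: "u \<noteq> 0" "c \<noteq> 0 \<or> d \<noteq> 0"
  shows "\<exists>A\<in>K. \<exists>B\<in>K. \<exists>s\<in>K. s \<noteq> 0 \<and>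
    16*A*c * (A\<^sup>2 + c\<^sup>2*s\<^sup>2) + 24*u * (A*B + c*d*s\<^sup>2) * (A*d + B*c) = - 1"
proof -
  have "(24 :: 'a) = 2 * 2 * 2 * 3" "(16 :: 'a) = 2 * 2 * 2 * 2"
    by simp_all
  then have nz': "(24 :: 'a) \<noteq> 0" "(16 :: 'a) \<noteq> 0"
    using assms(2,3) by (metis mult_eq_0_iff)+
  consider "c = 0" "d \<noteq> 0" | "c \<noteq> 0" "d \<noteq> 0" | "c \<noteq> 0" "d = 0"
    using nz by blast
  then show ?thesis
  proof cases
    case 1
    then show ?thesis
      using K nz nz' by (intro bexI[of _ 1] bexI[of _ "- 1 / (24*u*d)"]) (auto intro!: divide mult)
  next
    case 2
    have "24*u * (0 * B + c*d*1\<^sup>2) * (0 * d + B*c) = B * (24*u*c\<^sup>2*d)" for B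
      by (simp add: power2_eq_square mult_ac)
    then show ?thesis
      using K nz nz' 2
      by (intro bexI[of _ 0] bexI[of _ "- 1 / (24*u*c\<^sup>2*d)"] bexI[of _ 1])
        (auto intro!: divide mult power)
  next
    case 3
    \<comment> \<open>For \<open>d = 0\<close> and fixed \<open>A\<close> the equation is a conic in
      \<open>s\<close> and \<open>B\<close>. A nonzero constant term yields a point with
      \<open>s \<noteq> 0\<close>; the constants for \<open>A = 1\<close> and \<open>A = -1\<close>
      sum to \<open>-2\<close>, so one of them is nonzero.\<close>
    have "\<exists>A\<in>K. A \<noteq> 0 \<and> - 1 - 16*A^3*c \<noteq> 0"
    proof (cases "- 1 - 16*c = 0")
      case True
      then have "- 1 - 16*(- 1)^3*c = - 2"
        by Groebner_Basis.algebra
      then show ?thesis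
        using assms(2) by (intro bexI[of _ "- 1"]) auto
    qed (auto intro!: bexI[of _ 1])
    then obtain A where A: "A \<in> K" "A \<noteq> 0" "- 1 - 16*A^3*c \<noteq> 0"
      by blast
    have "\<exists>s\<in>K. \<exists>B\<in>K. s \<noteq> 0 \<and> (16*A*c^3) * s\<^sup>2 + (24*u*A*c) * B\<^sup>2 = - 1 - 16*A^3*c"
      using assms nz' A 3
      by (intro binary_form_represents_off_axis) (auto intro!: mult power diff)
    then obtain s B where sB: "s \<in> K" "B \<in> K" "s \<noteq> 0"
      and eq: "(16*A*c^3) * s\<^sup>2 + (24*u*A*c) * B\<^sup>2 = - 1 - 16*A^3*c"
      by blast
    have "16*A*c * (A\<^sup>2 + c\<^sup>2*s\<^sup>2) + 24*u * (A*B + c*d*s\<^sup>2) * (A*d + B*c) = - 1"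
      using eq \<open>d = 0\<close> by Groebner_Basis.algebra
    then show ?thesis
      using A sB by blast
  qed
qed

end

text \<open>Uniqueness of inverses identifies negation and inversion in the ring record with those
  of the type class.\<close>

lemma finite_subfield_if_subfield:
  fixes K :: "'a::{field,finite} set"
  assumes "subfield K ring_of_type_algebra"
  shows "finite_subfield K"
proof -
  let ?R = "ring_of_type_algebra :: 'a ring"
  interpret R: Ring.field ?R
    by (rule field_from_type_algebra)
  note S = subringE[OF subfieldE(1)[OF assms]]
  have add: "x + y \<in> K" if "x \<in> K" "y \<in> K" for x y
    using S(7)[OF that] by (simp add: ring_of_type_algebra_def)
  have mult: "x * y \<in> K" if "x \<in> K" "y \<in> K" for x y
    using S(6)[OF that] by (simp add: ring_of_type_algebra_def)
  have uminus: "- x \<in> K" if "x \<in> K" for x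
  proof -
    have "x + (\<ominus>\<^bsub>?R\<^esub> x) = 0"
      using R.r_neg[of x] by (simp add: ring_of_type_algebra_def)
    then have "\<ominus>\<^bsub>?R\<^esub> x = - x"
      by (simp add: eq_neg_iff_add_eq_0 add.commute)
    then show ?thesis
      using S(5)[OF that] by simp
  qed
  have inverse: "inverse x \<in> K" if "x \<in> K" for x
  proof (cases "x = 0")
    case False
    then have "x \<in> K - {\<zero>\<^bsub>?R\<^esub>}"
      using that by (simp add: ring_of_type_algebra_def)
    note I = R.subfield_m_inv[OF assms this]
    from I(2) have "x * (inv\<^bsub>?R\<^esub> x) = 1"
      by (simp add: ring_of_type_algebra_def)
    then have "inv\<^bsub>?R\<^esub> x = inverse x"
      by (metis inverse_unique)
    then show ?thesis
      using I(1) by simp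
  qed (use that in simp)
  show ?thesis
    using S(2,3) add mult uminus inverse
    by unfold_locales (simp_all add: ring_of_type_algebra_def)
qed

section \<open>Quadratic extension and its conjugation\<close>

text \<open>Asking for \<open>\<alpha> ^ q = - \<alpha>\<close> covers both square roots of
  non-residues and elements \<open>z - z ^ q\<close>.\<close>

locale quadratic_extension = finite_subfield K
  for K :: "'a::{field,finite} set" +
  fixes q :: nat and \<alpha> :: 'a
  assumes odd_q: "odd q" and card_K: "card K = q" and card_UNIV: "CARD('a) = q\<^sup>2"
    and power_add: "\<And>x y :: 'a. (x + y) ^ q = x ^ q + y ^ q"
    and conj_alpha: "\<alpha> ^ q = - \<alpha>" and alpha_nz: "\<alpha> \<noteq> 0" and two_nz: "(2 :: 'a) \<noteq> 0"
begin

lemma mem_iff: "x \<in> K \<longleftrightarrow> x ^ q = x"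
  using eq_fixed_points card_K by auto

lemma conj: "a \<in> K \<Longrightarrow> b \<in> K \<Longrightarrow> (a + b * \<alpha>) ^ q = a - b * \<alpha>"
  by (simp add: power_add power_mult_distrib conj_alpha mem_iff)

lemma conj_conj: "(x ^ q) ^ q = (x :: 'a)"
proof -
  have "x ^ card (UNIV :: 'a set) = x"
    by (rule power_card_eq_same) auto
  then show ?thesis
    by (simp add: card_UNIV power2_eq_square power_mult)
qed

text \<open>The summands are the parts of \<open>x\<close> fixed and negated by conjugation;
  dividing the latter by \<open>\<alpha>\<close> makes it fixed.\<close>

lemma decompose:
  obtains a b where "a \<in> K" "b \<in> K" "x = a + b * \<alpha>"
proof
  have neg: "(- y) ^ q = - (y ^ q)" for y :: 'a
    using odd_q by simp
  show "(x + x ^ q) / 2 \<in> K"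
  proof (rule divide)
    show "x + x ^ q \<in> K"
      by (simp add: mem_iff power_add conj_conj add.commute)
  qed simp
  have "x - x ^ q = x + - (x ^ q)"
    by simp
  then have "((x - x ^ q) / (2 * \<alpha>)) ^ q = (x ^ q - x) / (2 ^ q * - \<alpha>)"
    by (simp only: power_divide power_mult_distrib power_add neg conj_conj conj_alpha)
      (simp add: algebra_simps)
  also have "(2 :: 'a) ^ q = 2"
    using numeral mem_iff by blast
  finally show "(x - x ^ q) / (2 * \<alpha>) \<in> K"
    using alpha_nz two_nz by (simp add: mem_iff field_simps)
  show "x = (x + x ^ q) / 2 + (x - x ^ q) / (2 * \<alpha>) * \<alpha>"
  proof -
    have "(x + x ^ q) / 2 + (x - x ^ q) / (2 * \<alpha>) * \<alpha> = (x + x ^ q) / 2 + (x - x ^ q) / 2"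
      using alpha_nz by simp
    also have "\<dots> = (2 * x) / 2"
      by (simp flip: add_divide_distrib)
    finally show ?thesis
      using two_nz by simp
  qed
qed

lemma alpha_square: "\<alpha>\<^sup>2 \<in> K"
  by (simp add: mem_iff conj_alpha flip: power_mult power_mult_distrib)
    (simp add: mult.commute power_mult conj_alpha)

lemma eq_iff:
  assumes "a \<in> K" "b \<in> K" "a' \<in> K" "b' \<in> K"
  shows "a + b * \<alpha> = a' + b' * \<alpha> \<longleftrightarrow> a = a' \<and> b = b'"
proof
  assume eq: "a + b * \<alpha> = a' + b' * \<alpha>"
  then have "a - b * \<alpha> = a' - b' * \<alpha>"
    using conj assms by metis
  with eq have "(a + b * \<alpha>) + (a - b * \<alpha>) = (a' + b' * \<alpha>) + (a' - b' * \<alpha>)"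
    by simp
  then have "2 * a = 2 * a'"
    by simp
  then have "a = a'"
    using two_nz by simp
  with eq show "a = a' \<and> b = b'"
    using alpha_nz by simp
qed simp

text \<open>With \<open>y = x ^ q\<close> the trace is \<open>(x + y) * (x ^ 3 + y ^ 3)\<close>,
  where \<open>x + y = 2 * a\<close>.\<close>

lemma Tr_quartic:
  assumes "a \<in> K" "b \<in> K"
  defines "x \<equiv> a + b * \<alpha>"
  shows "Tr q (x ^ 4 + x ^ (q + 3)) = 4 * a\<^sup>2 * (a\<^sup>2 + 3 * \<alpha>\<^sup>2 * b\<^sup>2)"
proof -
  have x: "x ^ q = a - b * \<alpha>"
    unfolding x_def using assms by (intro conj)
  have "Tr q (x ^ 4 + x ^ (q + 3)) = x ^ 4 + x ^ q * x ^ 3 + ((x ^ q) ^ 4 + (x ^ q) ^ q * (x ^ q) ^ 3)"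
    by (simp add: Tr_def power_add Power.power_add power_mult_distrib mult.commute flip: power_mult)
  also have "\<dots> = x ^ 4 + x ^ q * x ^ 3 + ((x ^ q) ^ 4 + x * (x ^ q) ^ 3)"
    by (simp only: conj_conj)
  also have "\<dots> = 4 * a\<^sup>2 * (a\<^sup>2 + 3 * \<alpha>\<^sup>2 * b\<^sup>2)"
    unfolding x unfolding x_def by Groebner_Basis.algebra
  finally show ?thesis .
qed

lemma permutation_trace_poly_iff:
  fixes \<gamma> :: 'a
  shows "permutation_polynomial (trace_poly q \<gamma>) \<longleftrightarrow>
     inj (\<lambda>x. x + \<gamma> * Tr q (x ^ 4 + x ^ (q + 3)))"
proof -
  have eq: "poly (trace_poly q \<gamma>) = (\<lambda>x. x + \<gamma> * Tr q (x ^ 4 + x ^ (q + 3)))"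
    by (simp add: fun_eq_iff poly_trace_poly)
  then show ?thesis
    unfolding permutation_polynomial_def bij_def eq
    by (metis finite finite_UNIV_inj_surj)
qed

section \<open>Collisions when 3 is nonzero\<close>

lemma not_permutation:
  fixes \<gamma> :: 'a
  assumes "(3 :: 'a) \<noteq> 0" "\<gamma> \<noteq> 0"
  shows "\<not> permutation_polynomial (trace_poly q \<gamma>)"
proof
  assume inj: "permutation_polynomial (trace_poly q \<gamma>)"
  obtain c d where cd: "c \<in> K" "d \<in> K" "\<gamma> = c + d * \<alpha>"
    by (rule decompose)
  then have "c \<noteq> 0 \<or> d \<noteq> 0"
    using assms by auto
  then obtain A B s where ABs: "A \<in> K" "B \<in> K" "s \<in> K" "s \<noteq> 0"
    and eq: "16*A*c * (A\<^sup>2 + c\<^sup>2*s\<^sup>2) + 24*\<alpha>\<^sup>2 * (A*B + c*d*s\<^sup>2) * (A*d + B*c) = - 1"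
    using collision_equation_solvable[OF _ two_nz assms(1) alpha_square cd(1,2)]
      alpha_nz odd_q card_K by auto
  \<comment> \<open>These are \<open>m - s * \<gamma>\<close> and \<open>m + s * \<gamma>\<close>
    for the midpoint \<open>m = A + B * \<alpha>\<close>.\<close>
  define x y where "x = (A - s * c) + (B - s * d) * \<alpha>" and "y = (A + s * c) + (B + s * d) * \<alpha>"
  have gx: "Tr q (x ^ 4 + x ^ (q + 3)) =
      4 * (A - s * c)\<^sup>2 * ((A - s * c)\<^sup>2 + 3 * \<alpha>\<^sup>2 * (B - s * d)\<^sup>2)"
    unfolding x_def by (rule Tr_quartic) (use ABs cd in auto)
  have gy: "Tr q (y ^ 4 + y ^ (q + 3)) =
      4 * (A + s * c)\<^sup>2 * ((A + s * c)\<^sup>2 + 3 * \<alpha>\<^sup>2 * (B + s * d)\<^sup>2)"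
    unfolding y_def by (rule Tr_quartic) (use ABs cd in auto)
  have "Tr q (y ^ 4 + y ^ (q + 3)) - Tr q (x ^ 4 + x ^ (q + 3)) = 2 * s *
      (16*A*c * (A\<^sup>2 + c\<^sup>2*s\<^sup>2) + 24*\<alpha>\<^sup>2 * (A*B + c*d*s\<^sup>2) * (A*d + B*c))"
    unfolding gx gy by Groebner_Basis.algebra
  \<comment> \<open>Multiplied by \<open>\<gamma>\<close>, this drop cancels
    \<open>y - x = 2 * s * \<gamma>\<close>.\<close>
  then have drop: "Tr q (y ^ 4 + y ^ (q + 3)) = Tr q (x ^ 4 + x ^ (q + 3)) - 2 * s"
    unfolding eq by (simp add: algebra_simps)
  have step: "y = x + 2 * s * \<gamma>"
    unfolding x_def y_def cd by Groebner_Basis.algebra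
  have "x + \<gamma> * Tr q (x ^ 4 + x ^ (q + 3)) = y + \<gamma> * Tr q (y ^ 4 + y ^ (q + 3))"
    unfolding drop by (simp add: step algebra_simps)
  then have "x = y"
    using inj unfolding permutation_trace_poly_iff by (rule injD[rotated])
  then show False
    using step ABs assms two_nz by simp
qed

section \<open>Characteristic 3\<close>

lemma permutation_char_3:
  fixes \<gamma> :: 'a
  assumes three: "(3 :: 'a) = 0"
  shows "permutation_polynomial (trace_poly q \<gamma>) \<longleftrightarrow> \<alpha> * \<gamma> \<in> K"
proof -
  obtain c d where cd: "c \<in> K" "d \<in> K" "\<gamma> = c + d * \<alpha>"
    by (rule decompose)
  let ?f = "\<lambda>x. x + \<gamma> * Tr q (x ^ 4 + x ^ (q + 3))"
  have "(4 :: 'a) = 1 + 3"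
    by simp
  then have four: "(4 :: 'a) = 1"
    unfolding three by simp
  have f: "?f (a + b * \<alpha>) = (a + c * a ^ 4) + (b + d * a ^ 4) * \<alpha>" if "a \<in> K" "b \<in> K" for a b
    unfolding Tr_quartic[OF that] cd three four by Groebner_Basis.algebra
  have "\<alpha> * \<gamma> = d * \<alpha>\<^sup>2 + c * \<alpha>"
    unfolding cd by Groebner_Basis.algebra
  moreover have "d * \<alpha>\<^sup>2 + c * \<alpha> \<in> K \<longleftrightarrow> c = 0"
  proof
    assume "d * \<alpha>\<^sup>2 + c * \<alpha> \<in> K"
    then show "c = 0"
      using eq_iff[of "d * \<alpha>\<^sup>2 + c * \<alpha>" 0 "d * \<alpha>\<^sup>2" c] cd alpha_square by auto
  qed (use cd alpha_square in auto)
  moreover have "inj ?f \<longleftrightarrow> c = 0"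
  proof
    assume inj: "inj ?f"
    show "c = 0"
    proof (rule ccontr)
      assume c: "c \<noteq> 0"
      \<comment> \<open>Cubing is the Frobenius map here, hence injective, and so onto on the finite
        set \<open>K\<close>.\<close>
      have "x = y" if "x ^ 3 = y ^ 3" for x y :: 'a
      proof -
        have "(x - y) ^ 3 = x ^ 3 - y ^ 3 + 3 * (x * y * (y - x))"
          by Groebner_Basis.algebra
        then show ?thesis
          using that three by simp
      qed
      then have "inj_on (\<lambda>x. x ^ 3) K"
        by (auto simp: inj_on_def)
      then have "(\<lambda>x. x ^ 3) ` K = K"
        by (intro endo_inj_surj) auto
      moreover have "- 1 / c \<in> K"
        using cd by (intro divide uminus) auto
      ultimately obtain t where t: "t \<in> K" "- 1 / c = t ^ 3"
        by blast
      have ct: "c * t ^ 3 = - 1"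
        using c unfolding t(2)[symmetric] by simp
      have "t + c * t ^ 4 = t * (1 + c * t ^ 3)"
        by Groebner_Basis.algebra
      then have t0: "t + c * t ^ 4 = 0"
        by (simp add: ct)
      have dt: "d * t ^ 4 \<in> K"
        using t cd by (intro mult power)
      \<comment> \<open>The image of \<open>t\<close> has first coordinate zero, and
        \<open>?f\<close> fixes every such point, so \<open>t\<close> collides with its own
        image.\<close>
      have "?f (t + 0 * \<alpha>) = 0 + (0 + d * t ^ 4) * \<alpha>"
        by (rule trans[OF f[OF t(1) zero]]) (simp only: t0)
      also have "\<dots> = ?f (0 + (d * t ^ 4) * \<alpha>)"
        by (rule sym, rule trans[OF f[OF zero dt]]) simp
      finally have "?f (t + 0 * \<alpha>) = ?f (0 + (d * t ^ 4) * \<alpha>)" .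
      then have "t + 0 * \<alpha> = 0 + (d * t ^ 4) * \<alpha>"
        by (rule injD[OF inj])
      then show False
        using eq_iff[OF t(1) zero zero dt] ct by auto
    qed
  next
    assume c: "c = 0"
    show "inj ?f"
    proof (rule injI)
      fix x y assume eq: "?f x = ?f y"
      obtain a b where x: "a \<in> K" "b \<in> K" "x = a + b * \<alpha>"
        by (rule decompose)
      obtain a' b' where y: "a' \<in> K" "b' \<in> K" "y = a' + b' * \<alpha>"
        by (rule decompose)
      have "a + (b + d * a ^ 4) * \<alpha> = a' + (b' + d * a' ^ 4) * \<alpha>"
        using eq f[OF x(1,2)] f[OF y(1,2)] unfolding x(3) y(3) c by simp
      then have "a = a' \<and> b + d * a ^ 4 = b' + d * a' ^ 4"
        using x y cd by (subst (asm) eq_iff) auto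
      then show "x = y"
        using x y by auto
    qed
  qed
  ultimately show ?thesis
    by (simp add: permutation_trace_poly_iff)
qed

end

section \<open>Choice of \<open>\<alpha>\<close> in each characteristic\<close>

theorem corollary3p2:
  fixes q :: nat
    and K :: "'a::{field,finite} set"
    and \<gamma> :: 'a
  assumes "primepow q" and "odd q"
    and "CARD('a) = q\<^sup>2"
    and "subfield K ring_of_type_algebra" and "card K = q"
  shows "(CHAR('a) \<noteq> 3 \<longrightarrow>
            (permutation_polynomial (trace_poly q \<gamma>) \<longleftrightarrow> \<gamma> = 0)) \<and>
         (CHAR('a) = 3 \<longrightarrow>
            (\<forall>u \<alpha>. quadratic_nonresidue_in K u \<and> \<alpha>\<^sup>2 = u \<longrightarrow>
               (permutation_polynomial (trace_poly q \<gamma>) \<longleftrightarrow> \<alpha> * \<gamma> \<in> K)))"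
proof -
  interpret finite_subfield K
    by (rule finite_subfield_if_subfield) fact
  have prime: "Factorial_Ring.prime CHAR('a)"
    using prime_CHAR_semidom[where ?'a = 'a] finite_imp_CHAR_pos[where ?'a = 'a] by simp
  obtain p n where pn: "Factorial_Ring.prime p" "q = p ^ n"
    using assms(1) by (auto simp: primepow_def)
  \<comment> \<open>This shows that \<open>q\<close> is a power of the characteristic, which makes
    \<open>x ^ q\<close> additive.\<close>
  have "CHAR('a) dvd (p ^ n)\<^sup>2"
    using CHAR_dvd_CARD[where ?'a = 'a] assms(3) pn by simp
  then have p: "p = CHAR('a)"
    using prime pn(1) by (metis prime_dvd_power primes_dvd_imp_eq)
  have power_add: "(x + y) ^ q = x ^ q + y ^ q" for x y :: 'a
    by (rule freshmans_dream'[OF prime, of q n]) (simp add: pn p)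
  have numeral_nz: "(numeral m :: 'a) \<noteq> 0 \<longleftrightarrow> \<not> CHAR('a) dvd numeral m" for m
    using of_nat_eq_0_iff_char_dvd[where ?'a = 'a, of "numeral m"] by simp
  have "q \<noteq> 1"
    using assms(1) by auto
  then have "n \<noteq> 0"
    using pn by auto
  then have "odd CHAR('a)"
    using assms(2) pn p by auto
  then have two: "(2 :: 'a) \<noteq> 0"
    unfolding numeral_nz using prime by (metis primes_dvd_imp_eq two_is_prime_nat even_numeral)
  have K_iff: "x \<in> K \<longleftrightarrow> x ^ q = x" for x
    using eq_fixed_points assms(5) by auto
  have ext: "quadratic_extension K q \<alpha>" if "\<alpha> ^ q = - \<alpha>" "\<alpha> \<noteq> 0" for \<alpha>
    by unfold_locales (use assms power_add two that in auto)
  have "permutation_polynomial (trace_poly q \<gamma>) \<longleftrightarrow> \<gamma> = 0" if "CHAR('a) \<noteq> 3"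
  proof -
    have three: "(3 :: 'a) \<noteq> 0"
      unfolding numeral_nz
    proof
      assume "CHAR('a) dvd 3"
      then have "CHAR('a) \<le> 3"
        by (rule dvd_imp_le) simp
      moreover have "CHAR('a) \<noteq> 2"
        using \<open>odd CHAR('a)\<close> by auto
      ultimately show False
        using that prime_gt_1_nat[OF prime] by linarith
    qed
    have "q > 1"
      using \<open>q \<noteq> 1\<close> assms(2) by (cases q) auto
    then have "card K \<noteq> CARD('a)"
      using assms(3,5) by (simp add: power2_eq_square)
    \<comment> \<open>No non-residue is given in this case; \<open>z - z ^ q\<close> is nonzero and
      negated by conjugation.\<close>
    then obtain z where "z \<notin> K"
      by (metis UNIV_eq_I)
    have "z ^ CARD('a) = z"
      by (rule power_card_eq_same) auto
    then have conj_conj: "(z ^ q) ^ q = z"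
      by (simp add: assms(3) power2_eq_square power_mult)
    have "(z - z ^ q) ^ q = z ^ q + (- (z ^ q)) ^ q"
      using power_add[of z "- (z ^ q)"] by simp
    also have "\<dots> = - (z - z ^ q)"
      using assms(2) conj_conj by simp
    finally interpret quadratic_extension K q "z - z ^ q"
      using \<open>z \<notin> K\<close> K_iff by (intro ext) auto
    have "permutation_polynomial (trace_poly q (0 :: 'a))"
      by (simp add: permutation_trace_poly_iff)
    then show ?thesis
      using not_permutation three by blast
  qed
  moreover have "permutation_polynomial (trace_poly q \<gamma>) \<longleftrightarrow> \<alpha> * \<gamma> \<in> K"
    if "CHAR('a) = 3" "quadratic_nonresidue_in K (\<alpha>\<^sup>2)" for \<alpha>
  proof -
    have sq: "\<alpha>\<^sup>2 \<in> K" "\<alpha> \<notin> K"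
      using that(2) by (auto simp: quadratic_nonresidue_in_def)
    \<comment> \<open>Equal squares leave \<open>\<alpha> ^ q = \<alpha>\<close> or
      \<open>\<alpha> ^ q = - \<alpha>\<close>; the former would put \<open>\<alpha>\<close> in
      \<open>K\<close>.\<close>
    have "(\<alpha> ^ q)\<^sup>2 = \<alpha>\<^sup>2"
      using sq(1) by (simp add: K_iff mult.commute flip: power_mult)
    then have "\<alpha> ^ q = - \<alpha>"
      using sq(2) by (auto simp: power2_eq_iff K_iff)
    then interpret quadratic_extension K q \<alpha>
      using sq(2) by (intro ext) auto
    have "(3 :: 'a) = 0"
      using numeral_nz[of "Num.Bit1 Num.One"] that(1) by auto
    then show ?thesis
      by (rule permutation_char_3)
  qed
  ultimately show ?thesis
    by auto
qed

end
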